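(* For even $n$, any HNN representation of $\mathrm{MAJ}:\{0,1\}^n\to\{0,1\}$ requires at least $\frac{n}{2}+2$ anchors.
   Context: $\mathrm{MAJ}(x_1,\dots,x_n)=\mathbf{1}[x_1+\dots+x_n\ge n/2]$. Let $\Delta(\mathbf{x},\mathbf{y})=\|\mathbf{x}-\mathbf{y}\|_2^2$. An HNN representation of $f:\{0,1\}^n\to\{0,1\}$ is a pair of disjoint sets $P,N\subseteq\{0,1\}^n$ (anchors) such that $f(\mathbf{x})=1$ if some $\mathbf{p}\in P$ has $\Delta(\mathbf{x},\mathbf{p})<\Delta(\mathbf{x},\mathbf{q})$ for all $\mathbf{q}\in N$, and $f(\mathbf{x})=0$ if some $\mathbf{q}\in N$ has $\Delta(\mathbf{x},\mathbf{q})<\Delta(\mathbf{x},\mathbf{p})$ for all $\mathbf{p}\in P$; its number of anchors is $|P|+|N|$. *)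

theory Defs
  imports "HOL-Analysis.Analysis"
begin

definition boolean_cube :: "(real ^ 'n) set" where
  "boolean_cube = {x. \<forall>i. x $ i \<in> {0, 1}}"

definition MAJ :: "real ^ 'n \<Rightarrow> nat" where
  "MAJ x = (if (\<Sum>i\<in>UNIV. x $ i) \<ge> real CARD('n) / 2 then 1 else 0)"

definition sq_dist :: "real ^ 'n \<Rightarrow> real ^ 'n \<Rightarrow> real" where
  "sq_dist x y = (norm (x - y))\<^sup>2"

(* The nearest-anchor rule defines the value of f at every point of the cube, hence the
   equivalences: in particular, no point of the cube may be equidistant from its nearest
   anchors in P and in N. With implications from right to left only, such ties would be
   unconstrained and P = N = {} would represent every function. *)
definition HNN_representation ::
    "(real ^ 'n \<Rightarrow> nat) \<Rightarrow> (real ^ 'n) set \<Rightarrow> (real ^ 'n) set \<Rightarrow> bool" where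
  "HNN_representation f P N \<longleftrightarrow>
     f \<in> boolean_cube \<rightarrow> {0, 1} \<and>
     P \<subseteq> boolean_cube \<and> N \<subseteq> boolean_cube \<and> P \<inter> N = {} \<and>
     (\<forall>x\<in>boolean_cube.
        (f x = 1 \<longleftrightarrow> (\<exists>p\<in>P. \<forall>q\<in>N. sq_dist x p < sq_dist x q)) \<and>
        (f x = 0 \<longleftrightarrow> (\<exists>q\<in>N. \<forall>p\<in>P. sq_dist x q < sq_dist x p)))"

end

(* Identify cube points with subsets of the n = 2k coordinates. Comparing a k-set X with
   the (k-1)-set X - {i}, where the majority flips, shows that the anchor p in P deciding X
   contains i while the anchor q in N deciding X - {i} does not. Hence p contains X, and
   dually q is contained in X - {i}. Thus q is within distance k of X, so p is not the full
   set, which is at distance exactly k. So every k-set lies in a proper subset of the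
   coordinates belonging to P; picking one coordinate missed by each such subset gives a
   transversal contained in no k-set, so P has at least k + 1 elements, and N is nonempty. *)
theory Submission
  imports Defs
begin

definition char_vec :: "'n set \<Rightarrow> real ^ 'n" where
  "char_vec S = (\<chi> i. if i \<in> S then 1 else 0)"

lemma char_vec_nth [simp]: "char_vec S $ i = (if i \<in> S then 1 else 0)"
  by (simp add: char_vec_def)

lemma char_vec_in_cube [simp]: "char_vec S \<in> boolean_cube"
  by (simp add: boolean_cube_def)

lemma MAJ_char_vec:
  "MAJ (char_vec S :: real ^ 'n) = (if CARD('n) \<le> 2 * card S then 1 else 0)"
proof -
  have "(\<Sum>i\<in>UNIV. char_vec S $ i) = real (card S)"
    by (simp add: sum.If_cases)
  moreover have "real CARD('n) / 2 \<le> real (card S) \<longleftrightarrow> CARD('n) \<le> 2 * card S"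
    by linarith
  ultimately show ?thesis
    by (simp add: MAJ_def)
qed

lemma sq_dist_sum: "sq_dist x y = (\<Sum>i\<in>UNIV. (x $ i - y $ i)\<^sup>2)"
  by (simp add: sq_dist_def norm_vec_def L2_set_def sum_nonneg)

text \<open>Only the summand at \<open>i\<close> changes, and (1 - t)^2 = t^2 + 1 - 2t for every
  real t, so \<open>p\<close> need not lie in the cube.\<close>

lemma sq_dist_char_vec_insert:
  assumes "i \<notin> Y"
  shows "sq_dist (char_vec (insert i Y)) p = sq_dist (char_vec Y) p + 1 - 2 * p $ i"
proof -
  have "(\<Sum>j\<in>UNIV - {i}. (char_vec (insert i Y) $ j - p $ j)\<^sup>2) =
        (\<Sum>j\<in>UNIV - {i}. (char_vec Y $ j - p $ j)\<^sup>2)"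
    by (intro sum.cong) auto
  then show ?thesis
    using assms unfolding sq_dist_sum
    by (simp add: sum.remove[of UNIV i] power2_eq_square algebra_simps)
qed

text \<open>Inserting \<open>i\<close> shifts the two distances by 1 - 2 \<open>p $ i\<close> and 1
  - 2 \<open>q $ i\<close>. The order of the distances flips in favour of \<open>p\<close>, so
  \<open>q $ i < p $ i\<close>, and 0/1 values leave one possibility.\<close>

lemma opposite_decisions_coordinate:
  assumes "i \<notin> Y" "p \<in> boolean_cube" "q \<in> boolean_cube"
    and "sq_dist (char_vec (insert i Y)) p < sq_dist (char_vec (insert i Y)) q"
    and "sq_dist (char_vec Y) q < sq_dist (char_vec Y) p"
  shows "p $ i = 1" "q $ i = 0"
proof -
  have "q $ i < p $ i"
    using assms(4,5) sq_dist_char_vec_insert[OF assms(1)] by smt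
  moreover have "p $ i \<in> {0, 1}" "q $ i \<in> {0, 1}"
    using assms(2,3) by (auto simp: boolean_cube_def)
  ultimately show "p $ i = 1" "q $ i = 0"
    by auto
qed

lemma finite_boolean_cube: "finite (boolean_cube :: (real ^ 'n) set)"
proof -
  have "x = char_vec {i. x $ i = 1}" if "x \<in> boolean_cube" for x :: "real ^ 'n"
    using that by (force simp: boolean_cube_def vec_eq_iff)
  then have "boolean_cube \<subseteq> range (char_vec :: 'n set \<Rightarrow> _)"
    by blast
  then show ?thesis
    by (rule finite_subset) simp
qed

lemma majority_covering_anchor:
  fixes P N :: "(real ^ 'n) set"
  assumes rep: "HNN_representation MAJ P N"
    and k: "CARD('n) = 2 * k" and X: "card X = k" "X \<noteq> {}"
  shows "\<exists>p\<in>P. (\<forall>i\<in>X. p $ i = 1) \<and> (\<exists>i. p $ i = 0)"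
proof -
  have P: "P \<subseteq> boolean_cube" and N: "N \<subseteq> boolean_cube"
    using rep by (auto simp: HNN_representation_def)
  have decide_P: "\<exists>p\<in>P. \<forall>q\<in>N. sq_dist (char_vec S) p < sq_dist (char_vec S) q"
    if "card S = k" for S :: "'n set"
  proof -
    have "MAJ (char_vec S) = 1"
      using that k by (simp add: MAJ_char_vec)
    then show ?thesis
      using rep char_vec_in_cube unfolding HNN_representation_def by blast
  qed
  have decide_N: "\<exists>q\<in>N. \<forall>p\<in>P. sq_dist (char_vec S) q < sq_dist (char_vec S) p"
    if "card S < k" for S :: "'n set"
  proof -
    have "MAJ (char_vec S) = 0"
      using that k by (simp add: MAJ_char_vec)
    then show ?thesis
      using rep char_vec_in_cube unfolding HNN_representation_def by blast
  qed
  obtain p where p: "p \<in> P"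
    and p_near: "\<forall>q\<in>N. sq_dist (char_vec X) p < sq_dist (char_vec X) q"
    using decide_P[OF X(1)] by blast
  have card_remove: "card (X - {i}) < k" if "i \<in> X" for i
    using that X by (metis card_Diff1_less finite)
  \<comment> \<open>The opposing anchor \<open>q\<close> varies with \<open>i\<close>, while
    \<open>p\<close> stays the same.\<close>
  have contains: "p $ i = 1" if i: "i \<in> X" for i
  proof -
    obtain q where "q \<in> N"
      "\<forall>p\<in>P. sq_dist (char_vec (X - {i})) q < sq_dist (char_vec (X - {i})) p"
      using decide_N[OF card_remove[OF i]] by blast
    then show ?thesis
      using opposite_decisions_coordinate(1)[of i "X - {i}" p q] p p_near P N i
      by (auto simp: insert_absorb)
  qed
  have "\<exists>i. p $ i = 0"
  proof (rule ccontr)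
    assume "\<nexists>i. p $ i = 0"
    then have full: "p $ i = 1" for i
      using p P by (force simp: boolean_cube_def)
    obtain i where i: "i \<in> X"
      using X by blast
    define Y where "Y = X - {i}"
    obtain q where q: "q \<in> N"
      and q_near: "\<forall>p\<in>P. sq_dist (char_vec Y) q < sq_dist (char_vec Y) p"
      using decide_N[OF card_remove[OF i]] unfolding Y_def by blast
    \<comment> \<open>Now \<open>q\<close> is fixed and \<open>p'\<close> varies: \<open>Y\<close>
      has k - 1 elements, so adding any outside \<open>j\<close>, not just \<open>i\<close>, reaches
      the majority threshold.\<close>
    have q_zero: "q $ j = 0" if j: "j \<notin> Y" for j
    proof -
      have "card (insert j Y) = k"
        using j card_remove[OF i] X by (simp add: Y_def card_Diff_singleton i)
      then obtain p' where "p' \<in> P"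
        "\<forall>q\<in>N. sq_dist (char_vec (insert j Y)) p' < sq_dist (char_vec (insert j Y)) q"
        using decide_P by blast
      then show ?thesis
        using opposite_decisions_coordinate(2)[of j Y p' q] j q q_near P N by blast
    qed
    \<comment> \<open>Outside \<open>X\<close> both vectors vanish; inside, each coordinate costs at
      most 1.\<close>
    have "sq_dist (char_vec X) q \<le> (\<Sum>j\<in>UNIV. if j \<in> X then 1 else 0)"
      unfolding sq_dist_sum
    proof (rule sum_mono)
      fix j
      have "q $ j \<in> {0, 1}"
        using q N by (auto simp: boolean_cube_def)
      then show "(char_vec X $ j - q $ j)\<^sup>2 \<le> (if j \<in> X then 1 else 0)"
        using q_zero[of j] by (auto simp: Y_def)
    qed
    also have "\<dots> = real k"
      using X by (simp add: sum.If_cases)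
    \<comment> \<open>Here n = 2k enters: the complement of \<open>X\<close>, where the all-ones
      vector \<open>p\<close> differs from \<open>X\<close>, also has k elements.\<close>
    also have "real k = real (card (- X))"
      using X k by (simp add: card_Diff_subset Compl_eq_Diff_UNIV)
    also have "\<dots> = (\<Sum>j\<in>UNIV. if j \<in> X then 0 else 1)"
      by (simp add: sum.If_cases)
    also have "\<dots> = sq_dist (char_vec X) p"
      unfolding sq_dist_sum by (intro sum.cong) (auto simp: full)
    finally show False
      using p_near q by force
  qed
  with p contains show ?thesis
    by blast
qed

theorem theorem12:
  fixes P N :: "(real ^ 'n) set"
  assumes "even CARD('n)"
    and "HNN_representation MAJ P N"
  shows "real (card P + card N) \<ge> real CARD('n) / 2 + 2"
proof -
  obtain k where k: "CARD('n) = 2 * k"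
    using assms(1) by (elim evenE)
  then have "k > 0"
    by (metis finite_UNIV_card_ge_0 finite mult_0_right not_gr_zero)
  \<comment> \<open>An infinite set has \<open>card\<close> 0, so lower bounds on
    \<open>card\<close> require finiteness.\<close>
  have fin: "finite P" "finite N"
    using assms(2) finite_boolean_cube
    by (auto simp: HNN_representation_def intro: finite_subset)
  have "MAJ (char_vec {} :: real ^ 'n) = 0"
    using k \<open>k > 0\<close> by (simp add: MAJ_char_vec)
  then have "N \<noteq> {}"
    using assms(2) char_vec_in_cube unfolding HNN_representation_def by blast
  then have "card N \<ge> 1"
    using fin by (simp add: Suc_le_eq card_gt_0_iff)
  moreover have "card P \<ge> k + 1"
  proof (rule ccontr)
    assume "\<not> card P \<ge> k + 1"
    \<comment> \<open>For the all-ones vector the choice is arbitrary; \<open>missed\<close> is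
      evaluated as a zero only at an anchor known to have one.\<close>
    define missed :: "real ^ 'n \<Rightarrow> 'n" where "missed p = (SOME i. p $ i = 0)" for p
    have "card (missed ` P) \<le> k"
      using card_image_le[OF fin(1), of missed] \<open>\<not> card P \<ge> k + 1\<close> by linarith
    \<comment> \<open>The transversal is padded to exactly k of the 2k coordinates.\<close>
    then obtain X where X: "missed ` P \<subseteq> X" "card X = k"
      using exists_subset_between[of "missed ` P" k UNIV] k by auto
    with \<open>k > 0\<close> have "X \<noteq> {}"
      by auto
    then obtain p where p: "p \<in> P" "\<forall>i\<in>X. p $ i = 1" "\<exists>i. p $ i = 0"
      using majority_covering_anchor[OF assms(2) k X(2)] by blast
    have "p $ missed p = 0"
      unfolding missed_def using p(3) by (rule someI_ex)
    moreover have "p $ missed p = 1"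
      using p X by blast
    ultimately show False
      by simp
  qed
  ultimately show ?thesis
    using k by simp
qed

end
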